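(* Let $\mu$ be a finite (nonnegative) Borel measure on $\mathbb{R}^d$ and let $g$ be its Fourier transform, $$ g(\xi)=\int_{\mathbb{R}^d}e^{-2\pi i\,\xi\cdot x}\,d\mu(x),\qquad \xi\in\mathbb{R}^d . $$ Then $$ \bigl(|g(\xi_j-\xi_k)|^2\bigr)_{j,k=1}^n\succeq \frac{g(0)^2}{n}\,E_n $$ for every $n\ge 1$ and every choice of $\xi_1,\dots,\xi_n\in\mathbb{R}^d$.
   Context: $\xi\cdot x$ is the Euclidean inner product on $\mathbb{R}^d$. A matrix $M\in\mathbb{C}^{n\times n}$ is positive semidefinite if $c^*Mc\ge 0$ for all $c\in\mathbb{C}^n$. For self-adjoint matrices, $M\succeq N$ means that $M-N$ is positive semidefinite. $E_n\in\mathbb{R}^{n\times n}$ is the matrix with all entries equal to one. *)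

theory Defs
  imports "HOL-Analysis.Analysis"
begin

definition fourier_transform :: "(real ^ 'd) measure \<Rightarrow> real ^ 'd \<Rightarrow> complex" where
  "fourier_transform \<mu> \<xi> =
     (LINT x|\<mu>. exp (- (2 * complex_of_real pi * \<i> * complex_of_real (\<xi> \<bullet> x))))"

definition self_adjoint_matrix :: "complex ^ 'n ^ 'n \<Rightarrow> bool" where
  "self_adjoint_matrix M \<longleftrightarrow> (\<forall>j k. M $ j $ k = cnj (M $ k $ j))"

text \<open>
  The quadratic form is complex-valued; membership in \<open>\<real>\<^sub>\<ge>\<^sub>0\<close> says that it is
  real and nonnegative.
\<close>

definition positive_semidefinite :: "complex ^ 'n ^ 'n \<Rightarrow> bool" where
  "positive_semidefinite M \<longleftrightarrow>
     (\<forall>c. (\<Sum>j\<in>UNIV. cnj (c $ j) * (M *v c) $ j) \<in> \<real>\<^sub>\<ge>\<^sub>0)"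

text \<open>
  The order is meant for self-adjoint matrices only, so self-adjointness of both sides
  is part of the relation.
\<close>

definition loewner_ge :: "complex ^ 'n ^ 'n \<Rightarrow> complex ^ 'n ^ 'n \<Rightarrow> bool"
    (infix \<open>\<succeq>\<close> 50) where
  "M \<succeq> N \<longleftrightarrow>
     self_adjoint_matrix M \<and> self_adjoint_matrix N \<and> positive_semidefinite (M - N)"

definition all_ones_matrix :: "complex ^ 'n ^ 'n" where
  "all_ones_matrix = (\<chi> j k. 1)"

definition smult_matrix :: "complex \<Rightarrow> complex ^ 'n ^ 'n \<Rightarrow> complex ^ 'n ^ 'n" where
  "smult_matrix a M = (\<chi> j k. a * M $ j $ k)"

end

theory Submission
  imports Defs
begin

text \<open>
  Write \<open>G j k = g (\<xi> j - \<xi> k)\<close>. This kernel is positive semidefinite, because its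
  quadratic form is the integral of \<open>\<bar>\<Sum>j. cnj (c j) * exp (- 2 \<pi> \<i> \<xi> j \<bullet> x)\<bar>\<^sup>2\<close>
  (\<open>psd_kernel_fourier_transform\<close>). Hence it factors as \<open>G = B B\<^sup>*\<close> with a square matrix \<open>B\<close>
  (\<open>psd_kernel_gram\<close>). For \<open>D = diag c\<close> put \<open>T = B\<^sup>* D B\<close>. Then
  \<open>tr T = tr (D G) = g 0 * (\<Sum>j. c j)\<close>, and the squared Hilbert-Schmidt norm of \<open>T\<close> is
  \<open>tr (D\<^sup>* G D G) = (\<Sum>j k. cnj (c j) * c k * \<bar>G j k\<bar>\<^sup>2)\<close>, which is the quadratic form on
  the left of the claim. The theorem is therefore the inequality
  \<open>\<bar>tr T\<bar>\<^sup>2 \<le> n \<parallel>T\<parallel>\<^sup>2\<close>, that is, the Cauchy-Schwarz inequality applied to the \<open>n\<close>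
  diagonal entries of \<open>T\<close>. The constant \<open>1 / n\<close> comes from \<open>B\<close> having only \<open>n\<close> columns.
\<close>

section \<open>Gram factorisation of positive semidefinite kernels\<close>

text \<open>
  Kernels on an arbitrary finite set, rather than matrices indexed by a type, allow the
  factorisation to be proved by removing one index at a time.
\<close>

definition psd_kernel_on :: "'a set \<Rightarrow> ('a \<Rightarrow> 'a \<Rightarrow> complex) \<Rightarrow> bool" where
  "psd_kernel_on S G \<longleftrightarrow>
     (\<forall>j\<in>S. \<forall>k\<in>S. cnj (G j k) = G k j) \<and>
     (\<forall>c. 0 \<le> Re (\<Sum>j\<in>S. \<Sum>k\<in>S. cnj (c j) * c k * G j k))"

lemma psd_kernel_hermitian:
  "psd_kernel_on S G \<Longrightarrow> j \<in> S \<Longrightarrow> k \<in> S \<Longrightarrow> cnj (G j k) = G k j"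
  by (auto simp: psd_kernel_on_def)

lemma psd_kernel_form_nonneg:
  "psd_kernel_on S G \<Longrightarrow> 0 \<le> Re (\<Sum>j\<in>S. \<Sum>k\<in>S. cnj (c j) * c k * G j k)"
  unfolding psd_kernel_on_def by blast

lemma psd_kernel_diagonal:
  assumes "finite S" "psd_kernel_on S G" "a \<in> S"
  shows "G a a = of_real (Re (G a a))" "0 \<le> Re (G a a)"
proof -
  have "cnj (G a a) = G a a"
    using assms by (intro psd_kernel_hermitian)
  then show "G a a = of_real (Re (G a a))"
    by (metis Reals_cnj_iff of_real_Re)
  let ?c = "\<lambda>j. if j = a then 1 else 0 :: complex"
  have "(\<Sum>j\<in>S. \<Sum>k\<in>S. cnj (?c j) * ?c k * G j k)
      = (\<Sum>j\<in>S. \<Sum>k\<in>S. if k = a then (if j = a then G a a else 0) else 0)"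
    by (intro sum.cong) auto
  also have "\<dots> = G a a"
    using assms by (simp add: sum.delta)
  finally show "0 \<le> Re (G a a)"
    using psd_kernel_form_nonneg[OF assms(2), of ?c] by simp
qed

text \<open>
  The quadratic form split along one index \<open>a\<close>, whose coefficient \<open>t\<close> is left free for
  minimisation.
\<close>

lemma psd_kernel_insert_form:
  assumes "finite S" "a \<notin> S" and psd: "psd_kernel_on (insert a S) G"
  shows "0 \<le> Re (\<Sum>j\<in>S. \<Sum>k\<in>S. cnj (c j) * c k * G j k)
           + 2 * Re (cnj t * (\<Sum>k\<in>S. G a k * c k)) + (cmod t)\<^sup>2 * Re (G a a)"
proof -
  define w where "w = (\<Sum>k\<in>S. G a k * c k)"
  define Q where "Q = (\<Sum>j\<in>S. \<Sum>k\<in>S. cnj (c j) * c k * G j k)"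
  define c' where "c' = c(a := t)"
  have c': "c' j = c j" if "j \<in> S" for j
    using that assms(2) by (auto simp: c'_def)
  have c'a: "c' a = t"
    by (simp add: c'_def)
  have cw: "cnj w = (\<Sum>j\<in>S. cnj (c j) * G j a)"
    unfolding w_def cnj_sum using psd_kernel_hermitian[OF psd]
    by (intro sum.cong) (auto simp: mult.commute)
  have row: "(\<Sum>k\<in>S. cnj (c' a) * c' k * G a k) = cnj t * w"
    unfolding w_def sum_distrib_left c'a by (intro sum.cong) (auto simp: c')
  have col: "(\<Sum>j\<in>S. cnj (c' j) * c' a * G j a) = t * cnj w"
    unfolding cw sum_distrib_left c'a by (intro sum.cong) (auto simp: c')
  have block: "(\<Sum>j\<in>S. \<Sum>k\<in>S. cnj (c' j) * c' k * G j k) = Q"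
    unfolding Q_def by (intro sum.cong) (auto simp: c')
  have "(\<Sum>j\<in>insert a S. \<Sum>k\<in>insert a S. cnj (c' j) * c' k * G j k)
      = cnj t * t * G a a + cnj t * w + t * cnj w + Q"
    using assms(1,2) by (simp add: sum.distrib c'a flip: row[unfolded c'a] col[unfolded c'a] block)
  moreover have "cnj t * t * G a a = of_real ((cmod t)\<^sup>2 * Re (G a a))"
    using psd_kernel_diagonal(1)[OF _ psd, of a] assms(1)
    by (metis complex_norm_square finite_insert insertI1 mult.commute of_real_mult)
  moreover have "Re (t * cnj w) = Re (cnj t * w)"
    by simp
  ultimately have "Re (\<Sum>j\<in>insert a S. \<Sum>k\<in>insert a S. cnj (c' j) * c' k * G j k)
      = Re Q + 2 * Re (cnj t * w) + (cmod t)\<^sup>2 * Re (G a a)"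
    by (simp only: plus_complex.sel Re_complex_of_real)
  then show ?thesis
    using psd_kernel_form_nonneg[OF psd, of c'] unfolding w_def Q_def by simp
qed

text \<open>
  A vanishing pivot annihilates its row: otherwise the form would be affine in the
  coefficient of \<open>a\<close> with nonzero slope, hence negative somewhere.
\<close>

lemma psd_kernel_zero_pivot:
  assumes "finite S" "a \<notin> S" "psd_kernel_on (insert a S) G" "Re (G a a) = 0" "k \<in> S"
  shows "G a k = 0"
proof (rule ccontr)
  assume nz: "G a k \<noteq> 0"
  define c where "c = (\<lambda>j. if j = k then 1 else 0 :: complex)"
  define q where "q = Re (\<Sum>i\<in>S. \<Sum>j\<in>S. cnj (c i) * c j * G i j)"
  have w: "(\<Sum>j\<in>S. G a j * c j) = G a k"
    using assms(1,5) by (simp add: c_def if_distrib sum.delta cong: if_cong)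
  define s where "s = (\<bar>q\<bar> + 1) / (cmod (G a k))\<^sup>2"
  have "cnj (- of_real s * G a k) * G a k = of_real (- s * (cmod (G a k))\<^sup>2)"
    using complex_norm_square[of "G a k"] by (simp add: mult.commute)
  then have "0 \<le> q - 2 * (s * (cmod (G a k))\<^sup>2)"
    using psd_kernel_insert_form[OF assms(1-3), of c "- of_real s * G a k"]
    unfolding w assms(4) q_def[symmetric] by (simp only: Re_complex_of_real)
  then show False
    using nz by (simp add: s_def)
qed

text \<open>
  The form of the Schur complement at \<open>c\<close> is the minimum of the full form over the
  coefficient of \<open>a\<close>. If the pivot vanishes, division by zero makes the subtracted term vanish
  and the complement is just the restriction of \<open>G\<close>.
\<close>

lemma psd_kernel_schur_complement:
  assumes "finite S" "a \<notin> S" and psd: "psd_kernel_on (insert a S) G"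
  shows "psd_kernel_on S (\<lambda>j k. G j k - G j a * cnj (G k a) / of_real (Re (G a a)))"
  unfolding psd_kernel_on_def
proof (intro conjI ballI allI)
  fix j k assume "j \<in> S" "k \<in> S"
  then show "cnj (G j k - G j a * cnj (G k a) / of_real (Re (G a a)))
      = G k j - G k a * cnj (G j a) / of_real (Re (G a a))"
    using psd_kernel_hermitian[OF psd, of j k] by simp
next
  fix c
  define d where "d = Re (G a a)"
  define w where "w = (\<Sum>k\<in>S. G a k * c k)"
  define Q where "Q = (\<Sum>j\<in>S. \<Sum>k\<in>S. cnj (c j) * c k * G j k)"
  have cw: "cnj w = (\<Sum>j\<in>S. cnj (c j) * G j a)"
    unfolding w_def cnj_sum using psd_kernel_hermitian[OF psd]
    by (intro sum.cong) (auto simp: mult.commute)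
  have w': "w = (\<Sum>k\<in>S. c k * cnj (G k a))"
    unfolding w_def using psd_kernel_hermitian[OF psd]
    by (intro sum.cong) (auto simp: mult.commute)
  have "(\<Sum>j\<in>S. \<Sum>k\<in>S. cnj (c j) * c k * (G j k - G j a * cnj (G k a) / of_real d))
      = Q - (\<Sum>j\<in>S. \<Sum>k\<in>S. (cnj (c j) * G j a) * (c k * cnj (G k a))) / of_real d"
    by (simp add: Q_def algebra_simps sum_subtractf sum_divide_distrib)
  also have "(\<Sum>j\<in>S. \<Sum>k\<in>S. (cnj (c j) * G j a) * (c k * cnj (G k a))) = cnj w * w"
    by (subst cw, subst w') (simp add: sum_product)
  also have "cnj w * w = of_real ((cmod w)\<^sup>2)"
    using complex_norm_square[of w] by (simp add: mult.commute)
  finally have form: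
    "Re (\<Sum>j\<in>S. \<Sum>k\<in>S. cnj (c j) * c k * (G j k - G j a * cnj (G k a) / of_real d))
      = Re Q - (cmod w)\<^sup>2 / d"
    by (simp flip: of_real_power of_real_divide)
  have ineq: "0 \<le> Re Q + 2 * Re (cnj t * w) + (cmod t)\<^sup>2 * d" for t
    using psd_kernel_insert_form[OF assms] unfolding Q_def w_def d_def by blast
  have "0 \<le> Re Q - (cmod w)\<^sup>2 / d"
  proof (cases "d = 0")
    case True
    then show ?thesis using ineq[of 0] by simp
  next
    case False
    then have "d > 0"
      using psd_kernel_diagonal(2)[OF _ psd, of a] assms(1) by (simp add: d_def)
    have "cnj (- w / of_real d) * w = of_real (- ((cmod w)\<^sup>2 / d))"
      using complex_norm_square[of w] by (simp add: mult.commute)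
    moreover have "(cmod (- w / of_real d))\<^sup>2 * d = (cmod w)\<^sup>2 / d"
      using \<open>d > 0\<close> by (simp add: norm_divide power2_eq_square)
    ultimately show ?thesis
      using ineq[of "- w / of_real d"] by (simp only: Re_complex_of_real)
  qed
  then show "0 \<le> Re (\<Sum>j\<in>S. \<Sum>k\<in>S. cnj (c j) * c k *
                  (G j k - G j a * cnj (G k a) / of_real (Re (G a a))))"
    unfolding form[symmetric] unfolding d_def .
qed

text \<open>
  This is the Cholesky decomposition: the scaled row of the pivot \<open>a\<close> becomes one column
  of the factor, and the remaining columns factor the Schur complement. The factor has as many
  columns as \<open>S\<close> has elements, which is what the final estimate needs.
\<close>

lemma psd_kernel_gram:
  assumes "finite S" "psd_kernel_on S G"
  shows "\<exists>b. \<forall>j\<in>S. \<forall>k\<in>S. G j k = (\<Sum>i\<in>S. b i j * cnj (b i k))"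
  using assms
proof (induction S arbitrary: G rule: finite_induct)
  case empty
  then show ?case by simp
next
  case (insert a S)
  define d where "d = Re (G a a)"
  have psd: "psd_kernel_on (insert a S) G" by fact
  have Gaa: "G a a = of_real d" and "d \<ge> 0"
    using psd_kernel_diagonal[OF _ psd, of a] insert.hyps(1) by (auto simp: d_def)
  have herm: "cnj (G j k) = G k j" if "j \<in> insert a S" "k \<in> insert a S" for j k
    using psd_kernel_hermitian[OF psd] that by blast
  have zero: "G k a = 0" if "d = 0" "k \<in> insert a S" for k
    using that psd_kernel_zero_pivot[OF insert.hyps psd, folded d_def, of k] herm[of a k] Gaa
    by auto
  obtain b where b: "G j k - G j a * cnj (G k a) / of_real d = (\<Sum>i\<in>S. b i j * cnj (b i k))"
    if "j \<in> S" "k \<in> S" for j k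
    using insert.IH[OF psd_kernel_schur_complement[OF insert.hyps psd]]
    unfolding d_def by blast
  define b' where
    "b' = (\<lambda>i j. if i = a then G j a / of_real (sqrt d) else if j = a then 0 else b i j)"
  have pivot: "b' a j * cnj (b' a k) = G j a * cnj (G k a) / of_real d" for j k
    using \<open>d \<ge> 0\<close> by (simp add: b'_def flip: of_real_mult)
  have rest: "(\<Sum>i\<in>S. b' i j * cnj (b' i k))
      = (if j = a \<or> k = a then 0 else \<Sum>i\<in>S. b i j * cnj (b i k))" for j k
    using insert.hyps(2) by (auto simp: b'_def intro!: sum.neutral sum.cong)
  have "G j k = (\<Sum>i\<in>insert a S. b' i j * cnj (b' i k))"
    if jk: "j \<in> insert a S" "k \<in> insert a S" for j k
  proof (cases "j = a \<or> k = a")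
    case True
    have "G j k = G j a * cnj (G k a) / of_real d"
    proof (cases "d = 0")
      case True
      then show ?thesis
        using \<open>j = a \<or> k = a\<close> zero[of j] zero[of k] herm[of k j] jk by auto
    next
      case False
      then show ?thesis
        using \<open>j = a \<or> k = a\<close> herm[of k a] jk Gaa by auto
    qed
    with True show ?thesis
      using insert.hyps by (simp add: pivot rest)
  next
    case False
    then have "j \<in> S" "k \<in> S" using jk by auto
    with b[of j k] False show ?thesis
      using insert.hyps by (simp add: pivot rest algebra_simps)
  qed
  then show ?case by blast
qed

section \<open>The trace inequality\<close>

text \<open>
  In the proof, \<open>T\<close> stands for \<open>B\<^sup>* D B\<close>, and the existential statement keeps the left-hand form
  as an exact complex identity, which yields that it is real as well as the bound.
\<close>

lemma psd_kernel_norm_square_form: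
  assumes "finite S" "psd_kernel_on S G"
  shows "\<exists>r::real. (\<Sum>j\<in>S. \<Sum>k\<in>S. cnj (c j) * c k * of_real ((cmod (G j k))\<^sup>2)) = of_real r \<and>
           (cmod (\<Sum>j\<in>S. c j * G j j))\<^sup>2 \<le> real (card S) * r"
proof -
  obtain b where b: "G j k = (\<Sum>i\<in>S. b i j * cnj (b i k))" if "j \<in> S" "k \<in> S" for j k
    using psd_kernel_gram[OF assms] by blast
  define T where "T = (\<lambda>i l. \<Sum>k\<in>S. cnj (b i k) * c k * b l k)"
  define r where "r = (\<Sum>i\<in>S. \<Sum>l\<in>S. (cmod (T i l))\<^sup>2)"
  have "of_real r = (\<Sum>i\<in>S. \<Sum>l\<in>S. T i l * cnj (T i l))"
    by (simp only: r_def of_real_sum complex_norm_square)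
  also have "\<dots> = (\<Sum>i\<in>S. \<Sum>l\<in>S. \<Sum>k\<in>S. \<Sum>j\<in>S.
      cnj (c j) * c k * ((b i j * cnj (b i k)) * cnj (b l j * cnj (b l k))))"
    unfolding T_def cnj_sum sum_product by (intro sum.cong refl) simp
  also have "\<dots> = (\<Sum>i\<in>S. \<Sum>j\<in>S. \<Sum>k\<in>S. \<Sum>l\<in>S.
      cnj (c j) * c k * ((b i j * cnj (b i k)) * cnj (b l j * cnj (b l k))))"
  proof (rule sum.cong[OF refl])
    fix i
    let ?f = "\<lambda>j k l. cnj (c j) * c k * ((b i j * cnj (b i k)) * cnj (b l j * cnj (b l k)))"
    have "(\<Sum>l\<in>S. \<Sum>k\<in>S. \<Sum>j\<in>S. ?f j k l) = (\<Sum>l\<in>S. \<Sum>j\<in>S. \<Sum>k\<in>S. ?f j k l)"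
      by (rule sum.cong[OF refl], rule sum.swap)
    also have "\<dots> = (\<Sum>j\<in>S. \<Sum>l\<in>S. \<Sum>k\<in>S. ?f j k l)"
      by (rule sum.swap)
    also have "\<dots> = (\<Sum>j\<in>S. \<Sum>k\<in>S. \<Sum>l\<in>S. ?f j k l)"
      by (rule sum.cong[OF refl], rule sum.swap)
    finally show "(\<Sum>l\<in>S. \<Sum>k\<in>S. \<Sum>j\<in>S. ?f j k l) = (\<Sum>j\<in>S. \<Sum>k\<in>S. \<Sum>l\<in>S. ?f j k l)" .
  qed
  also have "\<dots> = (\<Sum>j\<in>S. \<Sum>i\<in>S. \<Sum>k\<in>S. \<Sum>l\<in>S.
      cnj (c j) * c k * ((b i j * cnj (b i k)) * cnj (b l j * cnj (b l k))))"
    by (rule sum.swap)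
  also have "\<dots> = (\<Sum>j\<in>S. \<Sum>k\<in>S. \<Sum>i\<in>S. \<Sum>l\<in>S.
      cnj (c j) * c k * ((b i j * cnj (b i k)) * cnj (b l j * cnj (b l k))))"
    by (rule sum.cong[OF refl], rule sum.swap)
  also have "\<dots> = (\<Sum>j\<in>S. \<Sum>k\<in>S. cnj (c j) * c k * (G j k * cnj (G j k)))"
    by (intro sum.cong refl) (simp only: b cnj_sum sum_product, simp only: sum_distrib_left)
  also have "\<dots> = (\<Sum>j\<in>S. \<Sum>k\<in>S. cnj (c j) * c k * of_real ((cmod (G j k))\<^sup>2))"
    by (simp only: complex_norm_square)
  finally have form:
    "(\<Sum>j\<in>S. \<Sum>k\<in>S. cnj (c j) * c k * of_real ((cmod (G j k))\<^sup>2)) = of_real r" ..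
  have "(\<Sum>j\<in>S. c j * G j j) = (\<Sum>j\<in>S. \<Sum>i\<in>S. cnj (b i j) * c j * b i j)"
    by (intro sum.cong refl) (simp add: b sum_distrib_left ac_simps)
  also have "\<dots> = (\<Sum>i\<in>S. T i i)"
    unfolding T_def by (rule sum.swap)
  finally have "cmod (\<Sum>j\<in>S. c j * G j j) \<le> (\<Sum>i\<in>S. cmod (T i i))"
    by (simp add: norm_sum)
  then have "(cmod (\<Sum>j\<in>S. c j * G j j))\<^sup>2 \<le> (\<Sum>i\<in>S. cmod (T i i))\<^sup>2"
    by (intro power_mono) auto
  also have "\<dots> \<le> real (card S) * (\<Sum>i\<in>S. (cmod (T i i))\<^sup>2)"
    using sum_squared_le_sum_of_squares[of "\<lambda>i. cmod (T i i)" S]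
    by (simp add: mult.commute)
  also have "(\<Sum>i\<in>S. (cmod (T i i))\<^sup>2) \<le> r"
    unfolding r_def using assms(1) by (intro sum_mono member_le_sum) auto
  finally show ?thesis
    using form by (auto simp: mult_left_mono)
qed

section \<open>Fourier transforms of finite measures\<close>

definition fourier_character :: "real ^ 'd \<Rightarrow> real ^ 'd \<Rightarrow> complex" where
  "fourier_character \<xi> x = exp (- (2 * complex_of_real pi * \<i> * complex_of_real (\<xi> \<bullet> x)))"

lemma cnj_fourier_character: "cnj (fourier_character \<xi> x) = fourier_character (- \<xi>) x"
  by (simp add: fourier_character_def exp_cnj)

lemma fourier_character_diff:
  "fourier_character (\<xi> - \<eta>) x = fourier_character \<xi> x * cnj (fourier_character \<eta> x)"
  unfolding cnj_fourier_character
  by (simp add: fourier_character_def inner_diff_left algebra_simps flip: exp_add)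

lemma integrable_fourier_character:
  assumes "finite_measure \<mu>" "sets \<mu> = sets borel"
  shows "integrable \<mu> (fourier_character \<xi>)"
proof -
  interpret finite_measure \<mu> by fact
  have "continuous_on UNIV (fourier_character \<xi>)"
    unfolding fourier_character_def by (intro continuous_intros)
  then have "fourier_character \<xi> \<in> borel_measurable \<mu>"
    using assms(2) measurable_cong_sets borel_measurable_continuous_onI by blast
  moreover have "norm (fourier_character \<xi> x) = 1" for x
    by (simp add: fourier_character_def norm_exp_eq_Re)
  ultimately show ?thesis
    by (intro integrable_const_bound[where B = 1]) auto
qed

lemma fourier_transform_eq: "fourier_transform \<mu> \<xi> = (LINT x|\<mu>. fourier_character \<xi> x)"
  by (simp add: fourier_transform_def fourier_character_def)

lemma fourier_transform_minus: "fourier_transform \<mu> (- \<xi>) = cnj (fourier_transform \<mu> \<xi>)"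
  by (simp add: fourier_transform_eq flip: cnj_fourier_character)

text \<open>The easy half of Bochner's theorem.\<close>

lemma psd_kernel_fourier_transform:
  assumes "finite_measure \<mu>" "sets \<mu> = sets borel"
  shows "psd_kernel_on S (\<lambda>j k. fourier_transform \<mu> (\<xi> j - \<xi> k))"
  unfolding psd_kernel_on_def
proof (intro conjI ballI allI)
  fix j k
  show "cnj (fourier_transform \<mu> (\<xi> j - \<xi> k)) = fourier_transform \<mu> (\<xi> k - \<xi> j)"
    using fourier_transform_minus[of \<mu> "\<xi> j - \<xi> k"] by simp
next
  fix c
  note int = integrable_fourier_character[OF assms]
  define F where "F = (\<lambda>x. \<Sum>j\<in>S. cnj (c j) * fourier_character (\<xi> j) x)"
  have pointwise: "(\<Sum>j\<in>S. \<Sum>k\<in>S. cnj (c j) * c k * fourier_character (\<xi> j - \<xi> k) x)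
      = of_real ((cmod (F x))\<^sup>2)" for x
    unfolding complex_norm_square F_def cnj_sum sum_product
    by (simp add: fourier_character_diff ac_simps)
  have "(\<Sum>j\<in>S. \<Sum>k\<in>S. cnj (c j) * c k * fourier_transform \<mu> (\<xi> j - \<xi> k))
      = (LINT x|\<mu>. (\<Sum>j\<in>S. \<Sum>k\<in>S. cnj (c j) * c k * fourier_character (\<xi> j - \<xi> k) x))"
    by (simp add: fourier_transform_eq int)
  also have "\<dots> = of_real (LINT x|\<mu>. (cmod (F x))\<^sup>2)"
    unfolding pointwise by (rule integral_complex_of_real)
  finally show "0 \<le> Re (\<Sum>j\<in>S. \<Sum>k\<in>S. cnj (c j) * c k * fourier_transform \<mu> (\<xi> j - \<xi> k))"
    by simp
qed

section \<open>The lower bound\<close>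

theorem theorem5:
  fixes \<mu> :: "(real ^ 'd) measure"
    and g :: "real ^ 'd \<Rightarrow> complex"
    and \<xi> :: "'n::finite \<Rightarrow> real ^ 'd"
  assumes "finite_measure \<mu>"
    and "sets \<mu> = sets borel"
    and "g = fourier_transform \<mu>"
  shows "(\<chi> j k. complex_of_real ((cmod (g (\<xi> j - \<xi> k)))\<^sup>2))
           \<succeq> smult_matrix ((g 0)\<^sup>2 / of_nat CARD('n)) all_ones_matrix"
proof -
  have sym: "cmod (g (\<xi> j - \<xi> k)) = cmod (g (\<xi> k - \<xi> j))" for j k
    using fourier_transform_minus[of \<mu> "\<xi> k - \<xi> j"] by (simp add: assms(3))
  have "cnj (g 0) = g 0"
    using fourier_transform_minus[of \<mu> 0] by (simp add: assms(3))
  then obtain m :: real where m: "g 0 = of_real m"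
    by (metis Reals_cases Reals_cnj_iff)
  let ?M = "(\<chi> j k. complex_of_real ((cmod (g (\<xi> j - \<xi> k)))\<^sup>2)) :: complex ^ 'n ^ 'n"
  let ?N = "smult_matrix ((g 0)\<^sup>2 / of_nat CARD('n)) all_ones_matrix :: complex ^ 'n ^ 'n"
  have "(\<Sum>j\<in>UNIV. cnj (c $ j) * ((?M - ?N) *v c) $ j) \<in> \<real>\<^sub>\<ge>\<^sub>0" for c :: "complex ^ 'n"
  proof -
    define s where "s = (\<Sum>j\<in>UNIV. c $ j)"
    obtain r :: real where r:
      "(\<Sum>j\<in>UNIV. \<Sum>k\<in>UNIV. cnj (c $ j) * c $ k * of_real ((cmod (g (\<xi> j - \<xi> k)))\<^sup>2)) = of_real r"
      "(cmod (\<Sum>j\<in>UNIV. c $ j * g 0))\<^sup>2 \<le> real CARD('n) * r"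
      using psd_kernel_norm_square_form[OF finite
          psd_kernel_fourier_transform[OF assms(1,2), of UNIV \<xi>], of "\<lambda>j. c $ j"]
      by (auto simp only: assms(3) diff_self)
    have "(\<Sum>j\<in>UNIV. c $ j * g 0) = s * g 0"
      by (simp add: s_def sum_distrib_right)
    then have bound: "(cmod s)\<^sup>2 * m\<^sup>2 / real CARD('n) \<le> r"
      using r(2) by (simp add: m norm_mult power_mult_distrib field_simps)
    have "(\<Sum>j\<in>UNIV. cnj (c $ j) * ((?M - ?N) *v c) $ j)
        = (\<Sum>j\<in>UNIV. \<Sum>k\<in>UNIV. cnj (c $ j) * c $ k * of_real ((cmod (g (\<xi> j - \<xi> k)))\<^sup>2))
          - (\<Sum>j\<in>UNIV. \<Sum>k\<in>UNIV. c $ k * cnj (c $ j)) * ((g 0)\<^sup>2 / of_nat CARD('n))"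
      by (simp add: matrix_vector_mult_def smult_matrix_def all_ones_matrix_def
          sum_distrib_left sum_distrib_right algebra_simps sum_subtractf)
    also have "(\<Sum>j\<in>UNIV. \<Sum>k\<in>UNIV. c $ k * cnj (c $ j)) = s * cnj s"
      by (subst sum.swap) (simp add: s_def sum_product)
    also have "s * cnj s = of_real ((cmod s)\<^sup>2)"
      by (rule complex_norm_square[symmetric])
    also have "(\<Sum>j\<in>UNIV. \<Sum>k\<in>UNIV. cnj (c $ j) * c $ k * of_real ((cmod (g (\<xi> j - \<xi> k)))\<^sup>2))
          - of_real ((cmod s)\<^sup>2) * ((g 0)\<^sup>2 / of_nat CARD('n))
        = of_real (r - (cmod s)\<^sup>2 * m\<^sup>2 / real CARD('n))"
      unfolding r(1) m by simp
    finally show ?thesis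
      using bound by (simp only: nonneg_Reals_of_real_iff diff_ge_0_iff_ge)
  qed
  then show ?thesis
    using sym by (simp add: loewner_ge_def self_adjoint_matrix_def positive_semidefinite_def
        smult_matrix_def all_ones_matrix_def m)
qed

end
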